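(* Let $n,k$ be integers with $1\leq k\leq n-3$ and let $G\in\mathfrak{C}'_{n,k}$. Then for every $v\in V(G)$, $f_G(v)\geq \frac{(n-k)^2+n+k+2}{2}$, and equality holds if and only if $G\cong L_{n,n-k}$ and $v$ is the pendant vertex of $L_{n,n-k}$.
   Context: All graphs are simple, finite, undirected and connected. A connected subgraph of $G$ is a subgraph (nonempty vertex subset with a subset of edges among them) that is connected; distinct subgraphs are counted separately. $f_G(v)$ is the number of connected subgraphs of $G$ containing the vertex $v$. $\mathfrak{C}_{n,k}$ is the family of connected graphs on $n$ vertices with exactly $k$ cut vertices, and $\mathfrak{C}'_{n,k}$ is the set of graphs in $\mathfrak{C}_{n,k}$ that are not trees. $L_{n,n-k}$ is the graph obtained by identifying an end vertex of the path $P_{k+1}$ with a vertex of the cycle $C_{n-k}$; it has $n$ vertices, $k$ cut vertices and a unique pendant vertex. *)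

theory Defs
  imports Complex_Main "Graph_Theory.Graph_Theory"
begin

text \<open>
  Finite simple undirected graphs are the symmetric loop-free digraphs
  \<^locale>\<open>pair_graph\<close>: an edge \<open>uv\<close> is the pair of arcs \<open>(u,v)\<close>, \<open>(v,u)\<close>.
  The predicate \<^const>\<open>Digraph_Component.connected\<close> entails nonemptiness.
\<close>

text \<open>
  A subgraph has to be symmetric itself, hence the \<open>pair_graph H\<close>; the bare
  \<^const>\<open>subgraph\<close> would also admit a single orientation of an edge.
\<close>

definition connected_subgraphs :: "'a pair_pre_digraph \<Rightarrow> 'a pair_pre_digraph set" where
  "connected_subgraphs G =
     {H. pair_graph H \<and> subgraph (with_proj H) (with_proj G)
         \<and> Digraph_Component.connected (with_proj H)}"

definition num_connected_subgraphs_at :: "'a pair_pre_digraph \<Rightarrow> 'a \<Rightarrow> nat" where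
  "num_connected_subgraphs_at G v = card {H \<in> connected_subgraphs G. v \<in> pverts H}"

text \<open>
  The nonemptiness condition is needed because the empty graph is not
  \<^const>\<open>Digraph_Component.connected\<close>; the vertex of the one-vertex graph is not a cut vertex.
\<close>

definition cut_vertex :: "'a pair_pre_digraph \<Rightarrow> 'a \<Rightarrow> bool" where
  "cut_vertex G v \<longleftrightarrow> v \<in> pverts G
     \<and> verts (pre_digraph.del_vert (with_proj G) v) \<noteq> {}
     \<and> \<not> Digraph_Component.connected (pre_digraph.del_vert (with_proj G) v)"

text \<open>
  The library's \<^const>\<open>tree\<close> is meant for digraphs: in a symmetric digraph every edge is a
  directed cycle of length 2. The cycles of the undirected graph are the directed ones of
  length at least 3.
\<close>

definition undirected_tree :: "'a pair_pre_digraph \<Rightarrow> bool" where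
  "undirected_tree G \<longleftrightarrow> Digraph_Component.connected (with_proj G)
     \<and> \<not> (\<exists>p. pre_digraph.cycle (with_proj G) p \<and> 3 \<le> length p)"

definition graphs_with_cut_vertices :: "nat \<Rightarrow> nat \<Rightarrow> 'a pair_pre_digraph set" where
  "graphs_with_cut_vertices n k =
     {G. pair_graph G \<and> Digraph_Component.connected (with_proj G)
         \<and> card (pverts G) = n \<and> card {v. cut_vertex G v} = k}"

definition nontree_graphs_with_cut_vertices :: "nat \<Rightarrow> nat \<Rightarrow> 'a pair_pre_digraph set" where
  "nontree_graphs_with_cut_vertices n k =
     {G \<in> graphs_with_cut_vertices n k. \<not> undirected_tree G}"

definition pendant_vertex :: "'a pair_pre_digraph \<Rightarrow> 'a \<Rightarrow> bool" where
  "pendant_vertex G v \<longleftrightarrow> v \<in> pverts G \<and> out_degree (with_proj G) v = 1"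

definition path_on :: "nat \<Rightarrow> nat \<Rightarrow> nat pair_pre_digraph" where
  "path_on a b = \<lparr> pverts = {a..b}, parcs = (\<Union>i\<in>{a..<b}. {(i, Suc i), (Suc i, i)}) \<rparr>"

definition cycle_on :: "nat \<Rightarrow> nat \<Rightarrow> nat pair_pre_digraph" where
  "cycle_on a b = \<lparr> pverts = {a..b}, parcs = parcs (path_on a b) \<union> {(b, a), (a, b)} \<rparr>"

text \<open>
  \<open>tadpole n g\<close> is the graph \<open>L\<^bsub>n,g\<^esub>\<close> for \<open>3 \<le> g \<le> n\<close>: the path on the \<open>n - g + 1\<close> vertices
  \<open>0, \<dots>, n - g\<close> and the cycle on the \<open>g\<close> vertices \<open>n - g, \<dots>, n - 1\<close> are identified in
  their only common vertex \<open>n - g\<close>.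
\<close>

definition tadpole :: "nat \<Rightarrow> nat \<Rightarrow> nat pair_pre_digraph" where
  "tadpole n g =
     \<lparr> pverts = pverts (path_on 0 (n - g)) \<union> pverts (cycle_on (n - g) (n - 1)),
       parcs = parcs (path_on 0 (n - g)) \<union> parcs (cycle_on (n - g) (n - 1)) \<rparr>"

definition graph_isomorphism ::
  "('a, 'a \<times> 'a, 'b, 'b \<times> 'b) digraph_isomorphism \<Rightarrow> 'a pair_pre_digraph \<Rightarrow> 'b pair_pre_digraph \<Rightarrow> bool"
where
  "graph_isomorphism \<phi> G H \<longleftrightarrow>
     pre_digraph.digraph_isomorphism (with_proj G) \<phi> \<and> with_proj H = app_iso \<phi> (with_proj G)"

end

theory Submission
  imports Defs
begin

text \<open>
  A connected subgraph containing \<open>v\<close> is determined by its edge set \<open>F\<close>, and the sets that arise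
  are those all of whose edges can be reached from \<open>v\<close> along \<open>F\<close>. Contracting edges at \<open>v\<close> is
  modelled by replacing \<open>v\<close> with a root set \<open>S\<close>: for an edge \<open>a = {s, w}\<close> with \<open>s\<close> in \<open>S\<close>, the
  number \<open>N(E, S)\<close> of such edge sets satisfies \<open>N(E, S) = N(E - a, S) + N(E - a, S \<union> {w})\<close>.

  Let \<open>c\<close> be the number of cut vertices outside \<open>S\<close> and \<open>m = |V - S| + 1 \<le> |E|\<close>, the latter because
  \<open>G\<close> is not a tree. By induction \<open>N(E, S) \<ge> c + (1 + \<dots> + (m - c)) + 1\<close>: if \<open>w\<close> is a cut vertex, the
  contraction loses one cut vertex and \<open>N(E - a, S) \<ge> 1\<close> suffices; otherwise every edge of \<open>E - a\<close> is
  still reached from \<open>S\<close>, so adding the edges one at a time gives \<open>N(E - a, S) \<ge> |E| \<ge> m\<close>.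
  In the case of equality, as long as there is a cut vertex, the root has degree one and its
  neighbour is a cut vertex; once there is none, \<open>E - a\<close> is a path and \<open>a\<close> joins its ends.
\<close>

section \<open>Edge sets reached from a root set\<close>

text \<open>Edges are bare sets of vertices: deleting an edge is set difference, and contracting it
  into the root only enlarges \<open>S\<close>, so no quotient graph is ever built.\<close>

inductive_set reach :: "'a set set \<Rightarrow> 'a set \<Rightarrow> 'a set" for F S where
  base: "x \<in> S \<Longrightarrow> x \<in> reach F S"
| step: "x \<in> reach F S \<Longrightarrow> e \<in> F \<Longrightarrow> x \<in> e \<Longrightarrow> y \<in> e \<Longrightarrow> y \<in> reach F S"

text \<open>Meeting the reached set once suffices, as it then swallows the whole edge. For
  \<open>S = {v}\<close> the empty edge set is rooted and stands for the subgraph with the single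
  vertex \<open>v\<close>.\<close>

definition rooted :: "'a set set \<Rightarrow> 'a set \<Rightarrow> bool" where
  "rooted F S \<longleftrightarrow> (\<forall>e\<in>F. e \<inter> reach F S \<noteq> {})"

definition num_rooted :: "'a set set \<Rightarrow> 'a set \<Rightarrow> nat" where
  "num_rooted E S = card {F. F \<subseteq> E \<and> rooted F S}"

lemma reach_superset: "S \<subseteq> reach F S"
  by (auto intro: reach.base)

lemma reach_least:
  assumes "S \<subseteq> T" "\<And>e. e \<in> F \<Longrightarrow> e \<inter> T \<noteq> {} \<Longrightarrow> e \<subseteq> T"
  shows "reach F S \<subseteq> T"
proof
  fix x assume "x \<in> reach F S"
  then show "x \<in> T"
    by induction (use assms in blast)+
qed

lemma reach_closed: "e \<in> F \<Longrightarrow> e \<inter> reach F S \<noteq> {} \<Longrightarrow> e \<subseteq> reach F S"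
  by (auto intro: reach.step)

lemma reach_mono: "F \<subseteq> F' \<Longrightarrow> S \<subseteq> S' \<Longrightarrow> reach F S \<subseteq> reach F' S'"
  using reach_superset[of S' F'] by (intro reach_least) (auto intro: reach.step)

text \<open>An edge that touches \<open>S\<close> has all its ends reached at once, so it can be
  traded for having these ends in the root set.\<close>

lemma reach_contract:
  assumes "a \<in> F" "a \<inter> S \<noteq> {}"
  shows "reach F S = reach (F - {a}) (S \<union> a)"
proof
  show "reach F S \<subseteq> reach (F - {a}) (S \<union> a)"
  proof (rule reach_least)
    show "S \<subseteq> reach (F - {a}) (S \<union> a)"
      using reach_superset[of "S \<union> a" "F - {a}"] by blast
    fix e assume "e \<in> F" "e \<inter> reach (F - {a}) (S \<union> a) \<noteq> {}"
    then show "e \<subseteq> reach (F - {a}) (S \<union> a)"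
      using reach_superset[of "S \<union> a" "F - {a}"] reach_closed[of e "F - {a}" "S \<union> a"]
      by (cases "e = a") auto
  qed
  have "a \<subseteq> reach F S"
    using assms reach_closed[of a F S] reach_superset[of S F] by blast
  then show "reach (F - {a}) (S \<union> a) \<subseteq> reach F S"
    using reach_superset[of S F] by (intro reach_least) (auto intro: reach.step)
qed

lemma rooted_contract:
  assumes "a \<in> F" "a \<inter> S \<noteq> {}"
  shows "rooted F S \<longleftrightarrow> rooted (F - {a}) (S \<union> a)"
proof -
  have "a \<inter> reach F S \<noteq> {}" using assms(2) reach_superset[of S F] by blast
  then show ?thesis
    unfolding rooted_def reach_contract[OF assms, symmetric] by blast
qed

lemma rooted_empty [simp]: "rooted {} S"
  by (simp add: rooted_def)

lemma finite_rooted: "finite E \<Longrightarrow> finite {F. F \<subseteq> E \<and> rooted F S}"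
  by (rule finite_subset[of _ "Pow E"]) auto

text \<open>Deletion and contraction: the rooted sets avoiding \<open>a\<close> give the first
  summand, and removing \<open>a\<close> from the others gives exactly the sets rooted at
  \<open>S \<union> a\<close>.\<close>

lemma num_rooted_contract:
  assumes "finite E" "a \<in> E" "a \<inter> S \<noteq> {}"
  shows "num_rooted E S = num_rooted (E - {a}) S + num_rooted (E - {a}) (S \<union> a)"
proof -
  let ?A = "{F. F \<subseteq> E - {a} \<and> rooted F S}"
  let ?B = "{F. F \<subseteq> E - {a} \<and> rooted F (S \<union> a)}"
  have "F \<in> insert a ` ?B" if "F \<subseteq> E" "rooted F S" "a \<in> F" for F
    using that rooted_contract[of a F S] assms by (intro image_eqI[of _ _ "F - {a}"]) auto
  moreover have "rooted (insert a F) S" if "F \<in> ?B" for F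
  proof -
    have "insert a F - {a} = F" using that by blast
    then show ?thesis
      using that rooted_contract[of a "insert a F" S] assms by simp
  qed
  ultimately have eq: "{F. F \<subseteq> E \<and> rooted F S} = ?A \<union> insert a ` ?B"
    using assms by auto
  have "inj_on (insert a) ?B"
    by (rule inj_onI) (metis (mono_tags, lifting) Diff_insert_absorb insertCI mem_Collect_eq subset_Diff_insert)
  then have "card (insert a ` ?B) = num_rooted (E - {a}) (S \<union> a)"
    by (simp add: card_image num_rooted_def)
  moreover have "?A \<inter> insert a ` ?B = {}" by auto
  ultimately show ?thesis
    using finite_rooted[of "E - {a}"] assms
    by (simp add: num_rooted_def eq card_Un_disjoint)
qed

lemma num_rooted_pos: "finite E \<Longrightarrow> 0 < num_rooted E S"
  unfolding num_rooted_def by (subst card_gt_0_iff) (use finite_rooted[of E S] in auto)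

lemma rooted_imp_meets:
  assumes "rooted E S" "E \<noteq> {}"
  obtains a where "a \<in> E" "a \<inter> S \<noteq> {}"
proof -
  have "\<exists>a\<in>E. a \<inter> S \<noteq> {}"
  proof (rule ccontr)
    assume c: "\<not> ?thesis"
    then have "reach E S \<subseteq> S" by (intro reach_least) auto
    then show False using assms c unfolding rooted_def by blast
  qed
  then show ?thesis using that by blast
qed

lemma num_rooted_no_edge_at_root:
  assumes "\<And>e. e \<in> E \<Longrightarrow> e \<inter> S = {}"
  shows "num_rooted E S = 1"
proof -
  have "F = {}" if "F \<subseteq> E" "rooted F S" for F
    using rooted_imp_meets[of F S] that assms by (metis subsetD)
  then have "{F. F \<subseteq> E \<and> rooted F S} = {{}}" by auto
  then show ?thesis by (simp add: num_rooted_def)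
qed

text \<open>An edge at the root would split the count into two positive summands.\<close>

lemma num_rooted_eq_1D:
  assumes "finite E" "num_rooted E S = 1" "e \<in> E"
  shows "e \<inter> S = {}"
proof (rule ccontr)
  assume "e \<inter> S \<noteq> {}"
  then show False
    using num_rooted_contract[of E e S] num_rooted_pos[of "E - {e}" S]
      num_rooted_pos[of "E - {e}" "S \<union> e"] assms
    by simp
qed

text \<open>The edges can be added one at a time so that every stage is rooted, which yields
  \<open>card E + 1\<close> sets. In the induction the deletion summand contributes only the empty
  set.\<close>

lemma num_rooted_ge_Suc_card:
  assumes "finite E" "rooted E S"
  shows "Suc (card E) \<le> num_rooted E S"
  using assms
proof (induction "card E" arbitrary: E S)
  case 0
  then show ?case using num_rooted_pos[of E S] by (simp add: Suc_leI)
next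
  case (Suc k)
  then obtain a where a: "a \<in> E" "a \<inter> S \<noteq> {}"
    by (metis card.empty nat.distinct(1) rooted_imp_meets)
  have "Suc (card (E - {a})) \<le> num_rooted (E - {a}) (S \<union> a)"
    using Suc a rooted_contract[of a E S] by (intro Suc.hyps) auto
  moreover have "0 < num_rooted (E - {a}) S"
    using Suc by (intro num_rooted_pos) auto
  moreover have "card E = Suc (card (E - {a}))"
    using a Suc by (simp add: card_Suc_Diff1)
  ultimately show ?case
    using num_rooted_contract[OF Suc.prems(1) a] by linarith
qed

text \<open>Contracting a two-element edge at the root adds at most one vertex to the root set; once
  no edge meets the root, nothing new is reached.\<close>

lemma card_reach_le:
  assumes "finite E" "finite S" "\<And>e. e \<in> E \<Longrightarrow> card e = 2"
  shows "card (reach E S) \<le> card S + card E"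
  using assms
proof (induction "card E" arbitrary: E S)
  case 0
  then have "reach E S \<subseteq> S" by (intro reach_least) auto
  then show ?case using 0 by (simp add: card_mono trans_le_add1)
next
  case (Suc k)
  show ?case
  proof (cases "\<exists>a\<in>E. a \<inter> S \<noteq> {}")
    case False
    then have "reach E S \<subseteq> S" by (intro reach_least) auto
    then show ?thesis using Suc by (simp add: card_mono trans_le_add1)
  next
    case True
    then obtain a s where a: "a \<in> E" "s \<in> a" "s \<in> S" by blast
    then obtain t where t: "a = {s, t}" using Suc by (metis card_2_iff insert_commute insertE singletonD)
    have "card (reach (E - {a}) (S \<union> a)) \<le> card (S \<union> a) + card (E - {a})"
      using Suc a t by (intro Suc.hyps) auto
    moreover have "S \<union> a = insert t S" using t a by auto
    moreover have "card E = Suc (card (E - {a}))"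
      using a Suc by (simp add: card_Suc_Diff1)
    moreover have "card (insert t S) \<le> Suc (card S)"
      by (rule card_insert_le_m1) auto
    moreover have "reach E S = reach (E - {a}) (S \<union> a)"
      using a by (intro reach_contract) auto
    ultimately show ?thesis by simp
  qed
qed

section \<open>The lower bound\<close>

text \<open>Cut vertices of the graph in which \<open>S\<close> is contracted to a point, apart from
  that point itself.\<close>

definition cuts :: "'a set \<Rightarrow> 'a set set \<Rightarrow> 'a set \<Rightarrow> 'a set" where
  "cuts V E S = {u \<in> V - S. \<not> V - {u} \<subseteq> reach {e \<in> E. u \<notin> e} S}"

text \<open>The invariant of the inductions: the graph is connected once \<open>S\<close> is
  contracted to a point. \<open>V\<close> stays fixed while \<open>E\<close> shrinks and
  \<open>S\<close> grows; edges with both ends in \<open>S\<close>, the loops of the contracted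
  graph, stay in \<open>E\<close>.\<close>

locale rooted_graph =
  fixes V :: "'a set" and E :: "'a set set" and S :: "'a set"
  assumes finV: "finite V" and SV: "S \<subseteq> V"
    and edge: "\<And>e. e \<in> E \<Longrightarrow> e \<subseteq> V \<and> card e = 2"
    and spanning: "V \<subseteq> reach E S"
begin

lemma finE: "finite E"
  using finV edge by (intro finite_subset[of E "Pow V"]) auto

lemma edge_other: "e \<in> E \<Longrightarrow> x \<in> e \<Longrightarrow> \<exists>y. e = {x, y} \<and> x \<noteq> y \<and> y \<in> V"
  using edge[of e] by (auto simp: card_2_iff)

lemma rooted: "rooted E S"
  unfolding rooted_def
proof
  fix e assume "e \<in> E"
  then have "e \<subseteq> reach E S" "e \<noteq> {}" using edge[of e] spanning by auto
  then show "e \<inter> reach E S \<noteq> {}" by blast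
qed

lemma reach_eq: "reach E S = V"
proof
  show "reach E S \<subseteq> V" using SV edge by (intro reach_least) auto
qed (rule spanning)

lemma leaving_edge:
  assumes "V \<noteq> S"
  obtains s w where "s \<in> S" "w \<in> V - S" "{s, w} \<in> E"
proof -
  have "\<exists>e\<in>E. e \<inter> S \<noteq> {} \<and> \<not> e \<subseteq> S"
  proof (rule ccontr)
    assume "\<not> ?thesis"
    then have "reach E S \<subseteq> S" by (intro reach_least) auto
    then show False using reach_eq SV assms by auto
  qed
  then obtain e s w where "e \<in> E" "s \<in> e" "s \<in> S" "w \<in> e" "w \<notin> S" by blast
  moreover from this have "e = {s, w}" using edge_other[of e s] by auto
  ultimately show ?thesis using that[of s w] edge by auto
qed

lemma contract:
  assumes "s \<in> S" "w \<in> V" "{s, w} \<in> E"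
  shows "rooted_graph V (E - {{s, w}}) (insert w S)"
proof
  have "S \<union> {s, w} = insert w S" using assms by auto
  then show "V \<subseteq> reach (E - {{s, w}}) (insert w S)"
    using spanning reach_contract[of "{s, w}" E S] assms by auto
qed (use finV SV edge assms in auto)

lemma num_rooted_contract_edge:
  assumes "s \<in> S" "{s, w} \<in> E"
  shows "num_rooted E S = num_rooted (E - {{s, w}}) S + num_rooted (E - {{s, w}}) (insert w S)"
proof -
  have "S \<union> {s, w} = insert w S" using assms by auto
  then show ?thesis using num_rooted_contract[OF finE, of "{s, w}" S] assms by auto
qed

text \<open>Deleting a vertex \<open>u\<close> outside \<open>insert w S\<close> commutes with
  contracting \<open>{s, w}\<close>, so \<open>u\<close> keeps its status; \<open>w\<close> is lost
  only because it joins the root.\<close>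

lemma cuts_contract:
  assumes "s \<in> S" "{s, w} \<in> E"
  shows "cuts V (E - {{s, w}}) (insert w S) = cuts V E S - {w}"
proof -
  have "reach {e \<in> E - {{s, w}}. u \<notin> e} (insert w S) = reach {e \<in> E. u \<notin> e} S"
    if "u \<notin> S" "u \<noteq> w" for u
  proof -
    have "S \<union> {s, w} = insert w S" using assms by auto
    moreover have "{e \<in> E - {{s, w}}. u \<notin> e} = {e \<in> E. u \<notin> e} - {{s, w}}" by auto
    moreover have "u \<noteq> s" using that assms by auto
    ultimately show ?thesis
      using reach_contract[of "{s, w}" "{e \<in> E. u \<notin> e}" S] assms that by auto
  qed
  then show ?thesis unfolding cuts_def by auto
qed

text \<open>As \<open>w\<close> is no cut vertex, all other vertices are reached without passing
  through \<open>w\<close>, hence without \<open>e\<close>. Each remaining edge has an end other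
  than \<open>w\<close>, so it is reached even if \<open>w\<close> no longer is.\<close>

lemma rooted_remove_edge:
  assumes "w \<in> V - S" "w \<in> e" "w \<notin> cuts V E S"
  shows "V - {w} \<subseteq> reach (E - {e}) S" "rooted (E - {e}) S"
proof -
  have "V - {w} \<subseteq> reach {e \<in> E. w \<notin> e} S"
    using assms by (auto simp: cuts_def)
  also have "\<dots> \<subseteq> reach (E - {e}) S"
    using assms by (intro reach_mono) auto
  finally show *: "V - {w} \<subseteq> reach (E - {e}) S" .
  show "rooted (E - {e}) S"
    unfolding rooted_def
  proof
    fix a assume "a \<in> E - {e}"
    then have "a \<subseteq> V" "\<not> a \<subseteq> {w}" using edge[of a] card_mono[of "{w}" a] by auto
    then show "a \<inter> reach (E - {e}) S \<noteq> {}" using * by blast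
  qed
qed

lemma card_le_num_rooted_remove_edge:
  assumes "w \<in> V - S" "w \<in> e" "e \<in> E" "w \<notin> cuts V E S"
  shows "card E \<le> num_rooted (E - {e}) S"
  using num_rooted_ge_Suc_card[OF _ rooted_remove_edge(2)[OF assms(1,2,4)]] finE assms
  by (simp add: card_Suc_Diff1 del: card_Diff_insert)

lemma finite_cuts: "finite (cuts V E S)"
  using finV by (simp add: cuts_def)

lemma card_cuts_le: "card (cuts V E S) \<le> card (V - S)"
  using finV by (intro card_mono) (auto simp: cuts_def)

end

text \<open>The inequality between vertices and edges says that the contracted graph has a cycle,
  possibly a loop or a pair of parallel edges. It survives contraction, which lowers both sides by
  one.\<close>

lemma num_rooted_lower_bound:
  assumes "rooted_graph V E S" "card (V - S) < card E"
  shows "card (cuts V E S) + (\<Sum>i\<le>Suc (card (V - S)) - card (cuts V E S). i) + 1 \<le> num_rooted E S"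
  using assms
proof (induction "card (V - S)" arbitrary: E S)
  case 0
  then interpret rooted_graph V E S by simp
  have "cuts V E S = {}" using card_cuts_le 0 finite_cuts by simp
  moreover have "Suc (card E) \<le> num_rooted E S"
    using num_rooted_ge_Suc_card finE rooted by blast
  ultimately show ?case using 0 by simp
next
  case (Suc d)
  interpret rooted_graph V E S by fact
  have "V \<noteq> S" using Suc.hyps(2) by auto
  then obtain s w where sw: "s \<in> S" "w \<in> V - S" "{s, w} \<in> E" by (rule leaving_edge)
  let ?E = "E - {{s, w}}" and ?S = "insert w S" and ?k = "card (cuts V E S)"
  have Vd: "V - ?S = V - S - {w}" by auto
  have d: "card (V - ?S) = d" unfolding Vd using Suc.hyps(2) sw finV by simp
  have cE: "card E = Suc (card ?E)"
    using sw finE card_Suc_Diff1[of E "{s, w}"] by simp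
  have IH: "card (cuts V ?E ?S) + (\<Sum>i\<le>Suc d - card (cuts V ?E ?S). i) + 1 \<le> num_rooted ?E ?S"
  proof -
    have "rooted_graph V ?E ?S" using sw by (intro contract) auto
    moreover have "card (V - ?S) < card ?E"
      using d cE Suc.prems(2) Suc.hyps(2) by linarith
    ultimately show ?thesis using Suc.hyps(1)[OF d[symmetric]] d by metis
  qed
  have rec: "num_rooted E S = num_rooted ?E S + num_rooted ?E ?S"
    using sw(1,3) by (rule num_rooted_contract_edge)
  have c: "cuts V ?E ?S = cuts V E S - {w}" using sw(1,3) by (rule cuts_contract)
  show ?case
  proof (cases "w \<in> cuts V E S")
    \<comment> \<open>The vertices outside the root and the cut vertices both drop by one, so the
      sum is unchanged; the missing unit is the empty set in \<open>num_rooted ?E S\<close>.\<close>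
    case True
    then have "?k = Suc (card (cuts V ?E ?S))"
      using c finite_cuts card_Suc_Diff1[of "cuts V E S" w] by simp
    then show ?thesis
      using IH rec num_rooted_pos[of ?E S] finE Suc.hyps(2)[symmetric] by simp
  next
    case False
    then have k: "card (cuts V ?E ?S) = ?k" using c by simp
    \<comment> \<open>This makes the truncated subtractions genuine, so the sum loses exactly its
      top term \<open>Suc (Suc d) - ?k\<close>, which is at most \<open>card E\<close>.\<close>
    have "?k \<le> d" using k rooted_graph.card_cuts_le[OF contract, of s w] sw d by auto
    then have "(\<Sum>i\<le>Suc (Suc d) - ?k. i) = (\<Sum>i\<le>Suc d - ?k. i) + (Suc (Suc d) - ?k)"
      by (simp add: Suc_diff_le)
    moreover have "card E \<le> num_rooted ?E S"
      using card_le_num_rooted_remove_edge[of w "{s, w}"] sw False by simp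
    ultimately show ?thesis
      using IH rec k Suc.prems(2) Suc.hyps(2)[symmetric] by simp
  qed
qed

section \<open>Paths, cycles and tadpoles\<close>

fun path_edges :: "'a list \<Rightarrow> 'a set set" where
  "path_edges (x # y # zs) = insert {x, y} (path_edges (y # zs))"
| "path_edges _ = {}"

lemma finite_path_edges [simp]: "finite (path_edges xs)"
  by (induction xs rule: path_edges.induct) auto

lemma path_edges_subset: "e \<in> path_edges xs \<Longrightarrow> e \<subseteq> set xs"
  by (induction xs rule: path_edges.induct) auto

lemma path_edges_snoc:
  "ys \<noteq> [] \<Longrightarrow> path_edges (ys @ [z]) = insert {last ys, z} (path_edges ys)"
  by (induction ys rule: path_edges.induct) auto

lemma path_edges_conv_nth: "path_edges xs = {{xs ! i, xs ! Suc i} | i. Suc i < length xs}"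
proof (induction xs rule: path_edges.induct)
  case (1 x y zs)
  have "{{(x # y # zs) ! i, (x # y # zs) ! Suc i} | i. Suc i < length (x # y # zs)} =
    insert {x, y} {{(y # zs) ! i, (y # zs) ! Suc i} | i. Suc i < length (y # zs)}" (is "?L = ?R")
  proof
    show "?L \<subseteq> ?R"
    proof
      fix e assume "e \<in> ?L"
      then obtain i where "e = {(x # y # zs) ! i, (x # y # zs) ! Suc i}" "Suc i < length (x # y # zs)"
        by blast
      then show "e \<in> ?R" by (cases i) auto
    qed
    have "{x, y} \<in> ?L" by (rule CollectI, rule exI[of _ 0]) simp
    moreover have "{(y # zs) ! i, (y # zs) ! Suc i} \<in> ?L" if "Suc i < length (y # zs)" for i
      using that by (intro CollectI exI[of _ "Suc i"]) simp
    ultimately show "?R \<subseteq> ?L" by blast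
  qed
  then show ?case using 1 by simp
qed auto

lemma num_rooted_empty [simp]: "num_rooted {} S = 1"
  by (rule num_rooted_no_edge_at_root) simp

text \<open>The rooted sets are the initial segments of the path: without its first edge only the
  empty set is left.\<close>

lemma num_rooted_path:
  assumes "x \<in> S" "distinct (x # xs)" "set xs \<inter> S = {}"
  shows "num_rooted (path_edges (x # xs)) S = Suc (length xs)"
  using assms
proof (induction xs arbitrary: x S)
  case Nil
  then show ?case by simp
next
  case (Cons y ys)
  let ?E = "path_edges (y # ys)"
  have "{x, y} \<notin> ?E" using path_edges_subset[of "{x, y}" "y # ys"] Cons.prems(2) by auto
  then have E: "path_edges (x # y # ys) - {{x, y}} = ?E" by simp
  have "num_rooted (path_edges (x # y # ys)) S = num_rooted ?E S + num_rooted ?E (S \<union> {x, y})"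
    using num_rooted_contract[of "path_edges (x # y # ys)" "{x, y}" S] Cons.prems(1)
    unfolding E by simp
  moreover have "num_rooted ?E S = 1"
  proof (rule num_rooted_no_edge_at_root)
    fix e assume "e \<in> ?E"
    from path_edges_subset[OF this] show "e \<inter> S = {}" using Cons.prems(3) by blast
  qed
  moreover have "num_rooted ?E (S \<union> {x, y}) = Suc (length ys)"
    using Cons.prems by (intro Cons.IH) auto
  ultimately show ?case by simp
qed

text \<open>Recursion on the closing edge: deleting it leaves a path, and contracting it puts the
  last vertex into the root, so that the last path edge becomes the new closing edge. This is why
  the closing edge may end at any \<open>t\<close> in \<open>S\<close>.\<close>

lemma num_rooted_cycle:
  assumes "x \<in> S" "distinct (x # xs)" "set xs \<inter> S = {}" "t \<in> S"
    and "{last (x # xs), t} \<notin> path_edges (x # xs)"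
  shows "num_rooted (insert {last (x # xs), t} (path_edges (x # xs))) S = (\<Sum>i\<le>Suc (length xs). i) + 1"
  using assms
proof (induction xs arbitrary: S t rule: rev_induct)
  case Nil
  have "num_rooted {{x, t}} S = num_rooted {} S + num_rooted {} (S \<union> {x, t})"
    using num_rooted_contract[of "{{x, t}}" "{x, t}" S] Nil by simp
  then show ?case by simp
next
  case (snoc z ys)
  let ?P = "path_edges (x # ys @ [z])"
  have P: "?P = insert {last (x # ys), z} (path_edges (x # ys))"
    using path_edges_snoc[of "x # ys" z] by simp
  have c: "{z, t} \<notin> ?P" using snoc.prems(5) by simp
  have Sz: "S \<union> {z, t} = insert z S" using snoc.prems(4) by auto
  have "insert {z, t} ?P - {{z, t}} = ?P" using c by simp
  then have "num_rooted (insert {z, t} ?P) S = num_rooted ?P S + num_rooted ?P (insert z S)"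
    using num_rooted_contract[of "insert {z, t} ?P" "{z, t}" S] snoc.prems(4) Sz by simp
  moreover have "num_rooted ?P S = Suc (length (ys @ [z]))"
    using snoc.prems by (intro num_rooted_path) auto
  moreover have "{last (x # ys), z} \<notin> path_edges (x # ys)"
    using path_edges_subset[of "{last (x # ys), z}" "x # ys"] snoc.prems(2) by auto
  then have "num_rooted ?P (insert z S) = (\<Sum>i\<le>Suc (length ys). i) + 1"
    unfolding P using snoc.prems by (intro snoc.IH) auto
  ultimately show ?case by simp
qed

text \<open>Along the tail a single edge leaves the root, so each step adds one and moves the root
  on; after \<open>k\<close> steps the cycle remains.\<close>

lemma num_rooted_tadpole:
  assumes "x \<in> S" "distinct (x # xs)" "set xs \<inter> S = {}" "k + 2 \<le> length xs"
  shows "num_rooted (insert {last (x # xs), (x # xs) ! k} (path_edges (x # xs))) S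
    = k + (\<Sum>i\<le>Suc (length xs) - k. i) + 1"
  using assms
proof (induction k arbitrary: x xs S)
  case 0
  then obtain y z zs where xs: "xs = y # z # zs"
    by (cases xs; cases "tl xs") auto
  \<comment> \<open>Here the cycle has at least three vertices: its last vertex is not the neighbour
    \<open>y\<close> of \<open>x\<close>, so the closing edge is a new one.\<close>
  have "{last (x # xs), x} \<notin> path_edges (x # xs)"
  proof
    assume "{last (x # xs), x} \<in> path_edges (x # xs)"
    then consider "{last (z # zs), x} = {x, y}" | "{last (z # zs), x} \<in> path_edges xs"
      using xs by auto
    then show False
    proof cases
      case 1
      then show False using last_in_set[of "z # zs"] 0(2) xs by (auto simp: doubleton_eq_iff)
    next
      case 2
      then show False using path_edges_subset[OF 2] 0(2) by simp
    qed
  qed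
  then show ?case using num_rooted_cycle[of x S xs x] 0 by simp
next
  case (Suc k)
  then obtain y ys where xs: "xs = y # ys" by (cases xs) auto
  let ?E = "insert {last (y # ys), (y # ys) ! k} (path_edges (y # ys))"
  have sub: "e \<subseteq> set (y # ys)" if "e \<in> ?E" for e
  proof -
    have "last (y # ys) \<in> set (y # ys)" by (rule last_in_set) simp
    moreover have "(y # ys) ! k \<in> set (y # ys)" using Suc.prems(4) xs by (intro nth_mem) simp
    ultimately show ?thesis using that path_edges_subset[of e] by blast
  qed
  have "{x, y} \<notin> ?E" using sub[of "{x, y}"] Suc.prems(2) xs by auto
  then have E: "insert {x, y} ?E - {{x, y}} = ?E" by simp
  have "num_rooted (insert {x, y} ?E) S = num_rooted ?E S + num_rooted ?E (S \<union> {x, y})"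
    using num_rooted_contract[of "insert {x, y} ?E" "{x, y}" S] Suc.prems(1)
    unfolding E by simp
  moreover have "num_rooted ?E S = 1"
    using sub Suc.prems(3) xs by (intro num_rooted_no_edge_at_root) blast
  moreover have "num_rooted ?E (S \<union> {x, y}) = k + (\<Sum>i\<le>Suc (length ys) - k. i) + 1"
    using Suc.prems xs by (intro Suc.IH) auto
  moreover have "insert {last (x # xs), (x # xs) ! Suc k} (path_edges (x # xs)) = insert {x, y} ?E"
    using xs by auto
  ultimately show ?case using xs by simp
qed

section \<open>The case of equality\<close>

text \<open>Equality in \<open>num_rooted_ge_Suc_card\<close> forces the deletion summand to be 1,
  so a single edge leaves the root. After its contraction only \<open>w\<close> carries edges, which
  restores the hypothesis on \<open>r\<close> and lets the path grow.\<close>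

lemma path_of_num_rooted_eq:
  assumes "rooted_graph V E S" "r \<in> S" "\<And>e. e \<in> E \<Longrightarrow> e \<inter> S \<subseteq> {r}"
    and "card E = card (V - S)" "num_rooted E S = Suc (card E)"
  shows "\<exists>xs. distinct (r # xs) \<and> set xs = V - S \<and> E = path_edges (r # xs)"
  using assms
proof (induction "card E" arbitrary: E S r)
  case 0
  interpret rooted_graph V E S by fact
  have "E = {}" using 0(1) finE by simp
  moreover from this have "V - S = {}" using 0(5) finV by simp
  ultimately show ?case by (intro exI[of _ "[]"]) simp
next
  case (Suc d)
  interpret rooted_graph V E S by fact
  have "V \<noteq> S" using Suc.hyps(2) Suc.prems(4) by auto
  then obtain s w where sw: "s \<in> S" "w \<in> V - S" "{s, w} \<in> E" by (rule leaving_edge)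
  have "s = r" using Suc.prems(3)[OF sw(3)] sw(1) by auto
  note sw = sw[unfolded this]
  let ?E = "E - {{r, w}}" and ?S = "insert w S"
  interpret c: rooted_graph V ?E ?S using sw by (intro contract) auto
  have cE: "card E = Suc (card ?E)"
    using sw finE card_Suc_Diff1[of E "{r, w}"] by simp
  have "V - ?S = V - S - {w}" by auto
  then have cV: "card ?E = card (V - ?S)" using cE sw finV Suc.prems(4) by simp
  have "num_rooted E S = num_rooted ?E S + num_rooted ?E ?S"
    using sw(1,3) by (rule num_rooted_contract_edge)
  moreover have "Suc (card ?E) \<le> num_rooted ?E ?S"
    using c.finE c.rooted by (rule num_rooted_ge_Suc_card)
  moreover have "0 < num_rooted ?E S" using c.finE by (rule num_rooted_pos)
  ultimately have N: "num_rooted ?E S = 1" "num_rooted ?E ?S = Suc (card ?E)"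
    using Suc.prems(5) cE by linarith+
  have "e \<inter> S = {}" if "e \<in> ?E" for e
    using c.finE N(1) that by (rule num_rooted_eq_1D)
  then have root: "e \<inter> ?S \<subseteq> {w}" if "e \<in> ?E" for e using that by blast
  have "\<exists>xs. distinct (w # xs) \<and> set xs = V - ?S \<and> ?E = path_edges (w # xs)"
    using Suc.hyps(1)[OF _ c.rooted_graph_axioms _ root cV N(2)] cE Suc.hyps(2) by simp
  then obtain xs where xs: "distinct (w # xs)" "set xs = V - ?S" "?E = path_edges (w # xs)"
    by blast
  have "distinct (r # w # xs)" using xs sw by auto
  moreover have "set (w # xs) = V - S" using xs sw by auto
  moreover have "E = path_edges (r # w # xs)" using xs(3) sw by auto
  ultimately show ?case by blast
qed

context rooted_graph
begin

text \<open>Without \<open>{r, w}\<close> the graph attains the minimal count, hence is a path from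
  \<open>r\<close>; the absence of cut vertices then forces \<open>w\<close> to be its far
  end.\<close>

lemma cycle_of_num_rooted_eq:
  assumes r: "r \<in> S" and root: "\<And>e. e \<in> E \<Longrightarrow> e \<inter> S \<subseteq> {r}"
    and w: "w \<in> V - S" "{r, w} \<in> E"
    and card: "card E = Suc (card (V - S))" "2 \<le> card (V - S)"
    and no_cut: "cuts V E S = {}"
    and eq: "num_rooted (E - {{r, w}}) S = card E"
  shows "\<exists>xs. distinct (r # xs) \<and> set xs = V - S \<and> E = insert {last (r # xs), r} (path_edges (r # xs))"
proof -
  let ?E = "E - {{r, w}}"
  have cE: "card E = Suc (card ?E)"
    using w finE card_Suc_Diff1[of E "{r, w}"] by simp
  have fE: "finite ?E" using finE by simp
  have rE: "rooted ?E S" and Vw: "V - {w} \<subseteq> reach ?E S"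
    using rooted_remove_edge[of w "{r, w}"] w no_cut by auto
  \<comment> \<open>Otherwise equality leaves just one edge \<open>a = {r, x}\<close> at the root
    besides \<open>{r, w}\<close>. Deleting \<open>x\<close> then leaves only \<open>S\<close> and
    \<open>w\<close> reached, and since \<open>x\<close> is no cut vertex, \<open>E\<close> has at
    most two edges instead of at least three.\<close>
  have w2: "\<exists>e\<in>?E. w \<in> e"
  proof (rule ccontr)
    assume now: "\<not> ?thesis"
    have "card ?E \<noteq> 0" using cE card by linarith
    then have "?E \<noteq> {}" by (metis card.empty)
    then obtain a where a: "a \<in> ?E" "a \<inter> S \<noteq> {}" using rooted_imp_meets[OF rE] by blast
    then have "r \<in> a" using root by auto
    then obtain x where x: "a = {r, x}" "x \<noteq> r" "x \<in> V" using edge_other[of a r] a by auto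
    then have xS: "x \<notin> S" using root[of a] a by auto
    have "rooted (?E - {a}) (S \<union> a)" using rooted_contract[OF a] rE by simp
    then have "Suc (card (?E - {a})) \<le> num_rooted (?E - {a}) (S \<union> a)"
      using fE by (intro num_rooted_ge_Suc_card) auto
    moreover have "Suc (card (?E - {a})) = card ?E"
      using fE a(1) by (rule card_Suc_Diff1)
    moreover have "0 < num_rooted (?E - {a}) S" using fE by (intro num_rooted_pos) auto
    ultimately have "num_rooted (?E - {a}) S = 1"
      using num_rooted_contract[OF fE a] eq cE by linarith
    then have off: "e \<inter> S = {}" if "e \<in> ?E - {a}" for e
      using num_rooted_eq_1D[of "?E - {a}" S e] that fE by simp
    have "reach {e \<in> E. x \<notin> e} S \<subseteq> S \<union> {w}"
    proof (rule reach_least)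
      fix e assume e: "e \<in> {e \<in> E. x \<notin> e}" "e \<inter> (S \<union> {w}) \<noteq> {}"
      show "e \<subseteq> S \<union> {w}"
      proof (cases "e = {r, w}")
        case False
        then have "e \<in> ?E - {a}" using e x by auto
        then show ?thesis using off[of e] now e by blast
      qed (use r in auto)
    qed auto
    moreover have "V - {x} \<subseteq> reach {e \<in> E. x \<notin> e} S"
      using no_cut x xS by (auto simp: cuts_def)
    ultimately have VS: "V - S \<subseteq> {w, x}" by blast
    have "E \<subseteq> {{r, w}, a}"
    proof
      fix e assume e: "e \<in> E"
      show "e \<in> {{r, w}, a}"
      proof (rule ccontr)
        assume "e \<notin> {{r, w}, a}"
        then have "e \<in> ?E - {a}" using e by auto
        then have "e \<subseteq> {x}" using off[of e] now VS edge[OF e] by blast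
        then have "card e \<le> 1" using card_mono[of "{x}" e] by simp
        then show False using edge[OF e] by simp
      qed
    qed
    then have "card E \<le> card {{r, w}, a}" by (intro card_mono) auto
    also have "\<dots> \<le> 2" using card_insert_le_m1[of 2 "{a}" "{r, w}"] by simp
    finally show False using card by simp
  qed
  then obtain y where y: "{w, y} \<in> ?E" "y \<noteq> w" "y \<in> V" using edge_other[of _ w] by blast
  then have "w \<in> reach ?E S"
    using Vw by (intro reach.step[of y ?E S "{w, y}" w]) auto
  then have "V \<subseteq> reach ?E S" using Vw by blast
  then have "rooted_graph V ?E S" using finV SV edge by unfold_locales auto
  then obtain xs where xs: "distinct (r # xs)" "set xs = V - S" "?E = path_edges (r # xs)"
    using path_of_num_rooted_eq[of V ?E S r] r root card eq cE by auto
  have len: "2 \<le> length xs" using xs distinct_card[of xs] card by simp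
  then obtain ys z where "xs = ys @ [z]" by (cases xs rule: rev_cases) auto
  with len have ys: "xs = ys @ [z]" "ys \<noteq> []" by auto
  \<comment> \<open>If \<open>{r, w}\<close> does not end at \<open>z\<close>, the only neighbour of
    \<open>z\<close> is the vertex before it on the path, which would be a cut vertex.\<close>
  have "w = z"
  proof (rule ccontr)
    assume wz: "w \<noteq> z"
    let ?y = "last ys"
    have lys: "?y \<in> set ys" using ys(2) by simp
    have zy: "z \<noteq> ?y" "z \<in> V" "z \<notin> S" "?y \<in> V - S" "z \<noteq> r" using lys xs ys by auto
    have "reach {e \<in> E. ?y \<notin> e} S \<subseteq> V - {z}"
    proof (rule reach_least)
      show "S \<subseteq> V - {z}" using SV zy by auto
      fix e assume e: "e \<in> {e \<in> E. ?y \<notin> e}"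
      have "z \<notin> e"
      proof (cases "e = {r, w}")
        case True
        then show ?thesis using wz zy by simp
      next
        case False
        then have "e \<in> path_edges ((r # ys) @ [z])" using e xs(3) ys(1) by auto
        then have "e \<in> path_edges (r # ys)" using path_edges_snoc[of "r # ys" z] e ys(2) by auto
        then show ?thesis using path_edges_subset[of e "r # ys"] xs(1) ys(1) by auto
      qed
      then show "e \<subseteq> V - {z}" using edge[of e] e by auto
    qed
    moreover have "V - {?y} \<subseteq> reach {e \<in> E. ?y \<notin> e} S"
      using no_cut zy(4) unfolding cuts_def by blast
    ultimately show False using zy by blast
  qed
  then have "{last (r # xs), r} = {r, w}" using ys by auto
  moreover have "E = insert {r, w} ?E" using w by auto
  ultimately have "E = insert {last (r # xs), r} (path_edges (r # xs))" using xs(3) by metis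
  then show ?thesis using xs by blast
qed

end

text \<open>Equality is traced through the induction for the lower bound: each cut vertex extends
  the tail by one edge, and the cycle closes when none is left.\<close>

lemma tadpole_of_num_rooted_eq:
  assumes "rooted_graph V E S" "r \<in> S" "\<And>e. e \<in> E \<Longrightarrow> e \<inter> S \<subseteq> {r}"
    and "card (V - S) < card E" "card (cuts V E S) = k" "k + 2 \<le> card (V - S)"
    and "num_rooted E S = k + (\<Sum>i\<le>Suc (card (V - S)) - k. i) + 1"
  shows "\<exists>xs. distinct (r # xs) \<and> set xs = V - S
    \<and> E = insert {last (r # xs), (r # xs) ! k} (path_edges (r # xs))"
  using assms
proof (induction k arbitrary: E S r)
  case 0
  interpret rooted_graph V E S by fact
  have "V \<noteq> S" using 0 by auto
  then obtain s w where sw: "s \<in> S" "w \<in> V - S" "{s, w} \<in> E" by (rule leaving_edge)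
  have "s = r" using 0(3)[OF sw(3)] sw(1) by auto
  note sw = sw[unfolded this]
  let ?E = "E - {{r, w}}" and ?S = "insert w S"
  interpret c: rooted_graph V ?E ?S using sw by (intro contract) auto
  have cE: "card E = Suc (card ?E)"
    using sw finE card_Suc_Diff1[of E "{r, w}"] by simp
  have "V - ?S = V - S - {w}" by auto
  then have cV: "card (V - S) = Suc (card (V - ?S))"
    using sw finV card_Suc_Diff1[of "V - S" w] by simp
  have cuts: "cuts V E S = {}" using 0(5) finite_cuts by simp
  have "cuts V ?E ?S = {}" using cuts_contract[OF sw(1,3)] cuts by simp
  then have "(\<Sum>i\<le>Suc (card (V - ?S)). i) + 1 \<le> num_rooted ?E ?S"
    using num_rooted_lower_bound[OF c.rooted_graph_axioms] cE cV 0(4) by simp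
  moreover have "num_rooted E S = num_rooted ?E S + num_rooted ?E ?S"
    using sw(1,3) by (rule num_rooted_contract_edge)
  moreover have "card E \<le> num_rooted ?E S"
    using card_le_num_rooted_remove_edge[of w "{r, w}"] sw cuts by simp
  moreover have "num_rooted E S = (\<Sum>i\<le>Suc (card (V - ?S)). i) + Suc (card (V - S)) + 1"
    using 0(7) cV by simp
  \<comment> \<open>The lower bounds for the two summands, together with
    \<open>Suc (card (V - S)) \<le> card E\<close>, already add up to the given total, so each of
    them is attained.\<close>
  ultimately have "num_rooted ?E S = card E" "card E = Suc (card (V - S))"
    using 0(4) by linarith+
  then show ?case
    using cycle_of_num_rooted_eq[of r w] sw 0 cuts by simp
next
  case (Suc k)
  interpret rooted_graph V E S by fact
  have "V \<noteq> S" using Suc.prems by auto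
  then obtain s w where sw: "s \<in> S" "w \<in> V - S" "{s, w} \<in> E" by (rule leaving_edge)
  have "s = r" using Suc.prems(3)[OF sw(3)] sw(1) by auto
  note sw = sw[unfolded this]
  let ?E = "E - {{r, w}}" and ?S = "insert w S"
  interpret c: rooted_graph V ?E ?S using sw by (intro contract) auto
  have cE: "card E = Suc (card ?E)"
    using sw finE card_Suc_Diff1[of E "{r, w}"] by simp
  have "V - ?S = V - S - {w}" by auto
  then have cV: "card (V - S) = Suc (card (V - ?S))"
    using sw finV card_Suc_Diff1[of "V - S" w] by simp
  have cuts: "cuts V ?E ?S = cuts V E S - {w}" using sw(1,3) by (rule cuts_contract)
  have rec: "num_rooted E S = num_rooted ?E S + num_rooted ?E ?S"
    using sw(1,3) by (rule num_rooted_contract_edge)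
  have lb: "card (cuts V ?E ?S) + (\<Sum>i\<le>Suc (card (V - ?S)) - card (cuts V ?E ?S). i) + 1
      \<le> num_rooted ?E ?S"
    using cE cV Suc.prems(4) by (intro num_rooted_lower_bound c.rooted_graph_axioms) simp
  \<comment> \<open>Otherwise the deletion summand is at least \<open>card E\<close>, while equality
    leaves room only for the top term of the sum, which is smaller by at least
    \<open>Suc k\<close>.\<close>
  have "w \<in> cuts V E S"
  proof (rule ccontr)
    assume "w \<notin> cuts V E S"
    then have "cuts V ?E ?S = cuts V E S" "card E \<le> num_rooted ?E S"
      using cuts card_le_num_rooted_remove_edge[of w "{r, w}"] sw by auto
    moreover have "Suc (card (V - S)) - Suc k = Suc (Suc (card (V - ?S)) - Suc k)"
      using cV Suc.prems(6) by simp
    then have "(\<Sum>i\<le>Suc (card (V - S)) - Suc k. i)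
      = (\<Sum>i\<le>Suc (card (V - ?S)) - Suc k. i) + (Suc (card (V - S)) - Suc k)"
      by (simp only: sum.atMost_Suc)
    ultimately show False using lb rec Suc.prems cV by simp
  qed
  then have k: "card (cuts V ?E ?S) = k"
    using cuts Suc.prems(5) finite_cuts by simp
  \<comment> \<open>The lower bound for the contracted graph is one below the total, so the deletion
    summand is exactly 1 and no edge but \<open>{r, w}\<close> meets the root.\<close>
  have "0 < num_rooted ?E S" using c.finE by (rule num_rooted_pos)
  then have N: "num_rooted ?E S = 1"
      "num_rooted ?E ?S = k + (\<Sum>i\<le>Suc (card (V - ?S)) - k. i) + 1"
    using lb[unfolded k] rec Suc.prems(7) cV by simp_all
  have "e \<inter> S = {}" if "e \<in> ?E" for e
    using c.finE N(1) that by (rule num_rooted_eq_1D)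
  then have root: "e \<inter> ?S \<subseteq> {w}" if "e \<in> ?E" for e using that by blast
  have "\<exists>xs. distinct (w # xs) \<and> set xs = V - ?S
      \<and> ?E = insert {last (w # xs), (w # xs) ! k} (path_edges (w # xs))"
    using Suc.prems(4,6) cE cV by (intro Suc.IH c.rooted_graph_axioms root k N(2)) auto
  then obtain xs where xs: "distinct (w # xs)" "set xs = V - ?S"
      "?E = insert {last (w # xs), (w # xs) ! k} (path_edges (w # xs))"
    by blast
  have "distinct (r # w # xs)" using xs sw by auto
  moreover have "set (w # xs) = V - S" using xs sw by auto
  moreover have "E = insert {r, w} ?E" using sw by auto
  then have "E = insert {last (r # w # xs), (r # w # xs) ! Suc k} (path_edges (r # w # xs))"
    unfolding xs(3) by (simp add: insert_commute)
  ultimately show ?case by blast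
qed

section \<open>Connected subgraphs as rooted edge sets\<close>

text \<open>The two arcs of an undirected edge collapse to one set, so its cardinality counts
  undirected edges.\<close>

definition edges_of :: "('a, 'b) pre_digraph \<Rightarrow> 'a set set" where
  "edges_of H = (\<lambda>e. {tail H e, head H e}) ` arcs H"

text \<open>Connectedness is strong connectedness of the symmetric closure, where it suffices to
  reach everything from \<open>v\<close>. The generality of \<open>wf_digraph\<close> covers the
  result of deleting a vertex.\<close>

lemma connected_iff_reach:
  assumes "wf_digraph H" "v \<in> verts H"
  shows "Digraph_Component.connected H \<longleftrightarrow> verts H \<subseteq> reach (edges_of H) {v}"
proof -
  interpret wf_digraph H by fact
  let ?M = "with_proj (mk_symmetric H)"
  interpret M: pair_wf_digraph "mk_symmetric H" by (rule wellformed_mk_symmetric)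
  have arc: "(x, y) \<in> parcs (mk_symmetric H) \<longleftrightarrow> {x, y} \<in> edges_of H" for x y
    unfolding edges_of_def parcs_mk_symmetric image_iff doubleton_eq_iff by auto
  have "reachable ?M v x \<longleftrightarrow> x \<in> reach (edges_of H) {v}" for x
  proof
    assume "reachable ?M v x"
    then have "(v, x) \<in> rtrancl_on (verts H) (parcs (mk_symmetric H))"
      by (simp add: reachable_def)
    then show "x \<in> reach (edges_of H) {v}"
    proof (induction rule: rtrancl_on_induct)
      case base
      then show ?case by (simp add: reach.base)
    next
      case (step y z)
      then show ?case using arc reach.step[of y "edges_of H" "{v}" "{y, z}" z] by auto
    qed
  next
    assume "x \<in> reach (edges_of H) {v}"
    then have "(v, x) \<in> rtrancl_on (verts H) (parcs (mk_symmetric H))"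
    proof induction
      case (base x)
      then show ?case using assms by auto
    next
      case (step x e y)
      show ?case
      proof (cases "x = y")
        case False
        then have "e = {x, y}" using step by (auto simp: edges_of_def)
        then have xy: "(x, y) \<in> parcs (mk_symmetric H)" using arc step by auto
        then have "y \<in> verts H" using M.in_arcsD2[of x y] by simp
        then show ?thesis using step.IH xy by (auto intro: rtrancl_on_into_rtrancl_on)
      qed (use step in simp)
    qed
    then show "reachable ?M v x" by (simp add: reachable_def)
  qed
  moreover have "reachable ?M x y"
    if "\<forall>x\<in>verts H. reachable ?M v x" "x \<in> verts H" "y \<in> verts H" for x y
    using that symmetric_reachable[OF symmetric_mk_symmetric, of H v x]
    by (auto intro: M.reachable_trans[of x v y])
  ultimately show ?thesis
    using assms(2) by (auto simp: Digraph_Component.connected_def strongly_connected_def)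
qed

lemma edges_of_del_vert:
  "edges_of (pre_digraph.del_vert H u) = {e \<in> edges_of H. u \<notin> e}"
  by (auto simp: edges_of_def pre_digraph.del_vert_def)

context pair_graph
begin

lemma wf: "wf_digraph (with_proj G)"
  by unfold_locales

lemma in_edges_of_iff: "{a, b} \<in> edges_of (with_proj G) \<longleftrightarrow> (a, b) \<in> parcs G"
proof
  assume "{a, b} \<in> edges_of (with_proj G)"
  then have "(a, b) \<in> parcs G \<or> (b, a) \<in> parcs G"
    by (auto simp: edges_of_def doubleton_eq_iff)
  then show "(a, b) \<in> parcs G" using arcs_symmetric by blast
qed (force simp: edges_of_def)

lemma edges_ofE:
  assumes "e \<in> edges_of (with_proj G)"
  obtains a b where "e = {a, b}" "(a, b) \<in> parcs G" "a \<noteq> b" "a \<in> pverts G" "b \<in> pverts G"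
  using assms in_arcsD1 in_arcsD2 no_loops' by (fastforce simp: edges_of_def)

lemma rooted_graph_edges_of:
  assumes "Digraph_Component.connected (with_proj G)" "v \<in> pverts G"
  shows "rooted_graph (pverts G) (edges_of (with_proj G)) {v}"
proof
  show "pverts G \<subseteq> reach (edges_of (with_proj G)) {v}"
    using connected_iff_reach[OF wf, of v] assms by simp
qed (use pair_finite_verts assms in \<open>auto elim!: edges_ofE\<close>)

text \<open>For \<open>u\<close> other than \<open>v\<close> the root survives the deletion of
  \<open>u\<close>, so connectedness of the rest can be tested from \<open>v\<close>.\<close>

lemma cuts_eq:
  assumes "v \<in> pverts G"
  shows "cuts (pverts G) (edges_of (with_proj G)) {v} = {u. cut_vertex G u} - {v}"
proof -
  have "cut_vertex G u \<longleftrightarrow> \<not> pverts G - {u} \<subseteq> reach {e \<in> edges_of (with_proj G). u \<notin> e} {v}"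
    if "u \<in> pverts G" "u \<noteq> v" for u
  proof -
    let ?D = "pre_digraph.del_vert (with_proj G) u"
    have "verts ?D = pverts G - {u}" by (simp add: pre_digraph.del_vert_def)
    then show ?thesis
      using connected_iff_reach[OF wf_digraph_del_vert, of v u] that assms
      by (auto simp: cut_vertex_def edges_of_del_vert)
  qed
  then show ?thesis by (auto simp: cuts_def cut_vertex_def)
qed

end

text \<open>A connected subgraph containing \<open>v\<close> has no isolated vertex except possibly
  \<open>v\<close>, so its edges determine it; the inverse \<open>g\<close> takes their ends and
  always adds \<open>v\<close>.\<close>

lemma num_connected_subgraphs_at_eq:
  assumes "pair_graph G" "v \<in> pverts G"
  shows "num_connected_subgraphs_at G v = num_rooted (edges_of (with_proj G)) {v}"
proof -
  interpret pair_graph G by fact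
  let ?E = "edges_of (with_proj G)"
  let ?A = "{H \<in> connected_subgraphs G. v \<in> pverts H}"
  let ?B = "{F. F \<subseteq> ?E \<and> rooted F {v}}"
  define f :: "'a pair_pre_digraph \<Rightarrow> 'a set set" where "f H = edges_of (with_proj H)" for H
  define g where "g F = \<lparr>pverts = insert v (\<Union>F), parcs = {(a, b). {a, b} \<in> F}\<rparr>" for F
  have fg: "f (g F) = F" if "F \<subseteq> ?E" for F
  proof
    show "f (g F) \<subseteq> F" by (auto simp: f_def g_def edges_of_def)
    show "F \<subseteq> f (g F)"
    proof
      fix e assume e: "e \<in> F"
      with that have "e \<in> ?E" by blast
      then obtain a b where ab: "e = {a, b}" by (rule edges_ofE)
      then show "e \<in> f (g F)"
        unfolding f_def g_def edges_of_def using e by (intro image_eqI[of _ _ "(a, b)"]) auto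
    qed
  qed
  have "bij_betw f ?A ?B"
  proof (rule bij_betw_byWitness[where f' = g])
    show "\<forall>H\<in>?A. g (f H) = H"
    proof
      fix H assume H: "H \<in> ?A"
      then interpret H: pair_graph H by (simp add: connected_subgraphs_def)
      have "pverts H \<subseteq> reach (f H) {v}"
        using H connected_iff_reach[OF H.wf, of v] by (simp add: connected_subgraphs_def f_def)
      also have "\<dots> \<subseteq> insert v (\<Union>(f H))"
        by (rule reach_least) auto
      finally have "pverts H = insert v (\<Union>(f H))"
        using H by (auto simp: f_def elim!: H.edges_ofE)
      then show "g (f H) = H"
        by (simp add: g_def f_def H.in_edges_of_iff)
    qed
    show "\<forall>F\<in>?B. f (g F) = F" using fg by blast
    show "f ` ?A \<subseteq> ?B"
    proof safe
      fix H assume H: "H \<in> connected_subgraphs G" "v \<in> pverts H"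
      then interpret H: pair_graph H by (simp add: connected_subgraphs_def)
      interpret rooted_graph "pverts H" "f H" "{v}"
        using H unfolding f_def by (intro H.rooted_graph_edges_of) (auto simp: connected_subgraphs_def)
      show "rooted (f H) {v}" by (rule rooted)
      show "e \<in> ?E" if "e \<in> f H" for e
        using that H by (auto simp: f_def edges_of_def connected_subgraphs_def subgraph_def)
    qed
    show "g ` ?B \<subseteq> ?A"
    proof safe
      fix F assume F: "F \<subseteq> ?E" "rooted F {v}"
      have arcs: "parcs (g F) \<subseteq> parcs G" using F in_edges_of_iff by (auto simp: g_def)
      have verts: "pverts (g F) \<subseteq> pverts G"
        using F assms(2) by (fastforce simp: g_def elim!: edges_ofE)
      interpret gF: pair_graph "g F"
      proof
        show "symmetric (with_proj (g F))"
          by (auto simp: symmetric_def g_def insert_commute intro!: symI)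
        show "finite (pverts (g F))" using verts pair_finite_verts by (rule finite_subset)
        show "finite (parcs (g F))" using arcs pair_finite_arcs by (rule finite_subset)
        fix e assume e: "e \<in> parcs (g F)"
        then show "fst e \<in> pverts (g F)" "snd e \<in> pverts (g F)" by (auto simp: g_def)
        show "fst e \<noteq> snd e" using e arcs no_loops'[of "fst e" "snd e"] by auto
      qed
      have "e \<subseteq> reach F {v}" if "e \<in> F" for e
        using F(2) that by (intro reach_closed) (auto simp: rooted_def)
      then have "insert v (\<Union>F) \<subseteq> reach F {v}"
        using reach.base[of v "{v}" F] by auto
      then have "Digraph_Component.connected (with_proj (g F))"
        using connected_iff_reach[OF gF.wf, of v] fg[OF F(1)] by (simp add: f_def g_def)
      moreover have "subgraph (with_proj (g F)) (with_proj G)"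
        using verts arcs wf gF.wf by (simp add: subgraph_def compatible_def)
      ultimately show "g F \<in> connected_subgraphs G"
        using gF.pair_graph_axioms by (simp add: connected_subgraphs_def)
      show "v \<in> pverts (g F)" by (simp add: g_def)
    qed
  qed
  then show ?thesis
    by (simp add: num_connected_subgraphs_at_def num_rooted_def bij_betw_same_card)
qed

section \<open>Counting the edges of a connected graph with a cycle\<close>

lemma pcas_reach:
  assumes "pcas x q y" "x \<in> reach F S" "\<And>a. a \<in> set q \<Longrightarrow> {fst a, snd a} \<in> F"
  shows "y \<in> reach F S"
  using assms
proof (induction q arbitrary: x)
  case (Cons a q)
  have "snd a \<in> reach F S"
    using Cons.prems(1,2) Cons.prems(3)[of a] reach.step[of x F S "{fst a, snd a}" "snd a"] by simp
  then show ?case using Cons.IH[of "snd a"] Cons.prems by simp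
qed simp

lemma pcas_arc_verts:
  "pcas x q y \<Longrightarrow> a \<in> set q \<Longrightarrow> {fst a, snd a} \<subseteq> set (pawalk_verts x q)"
proof (induction q arbitrary: x)
  case (Cons b q)
  have "z \<in> set (pawalk_verts z q)" if "pcas z q y" for z
    using that by (cases q) auto
  then show ?case using Cons by auto
qed simp

lemma pcas_last: "pcas x q y \<Longrightarrow> y \<in> set (pawalk_verts x q)"
  by (induction q arbitrary: x) auto

lemma card_verts_le_card_edges:
  assumes "pair_graph G" "Digraph_Component.connected (with_proj G)" "\<not> undirected_tree G"
  shows "card (pverts G) \<le> card (edges_of (with_proj G))"
proof -
  interpret pair_graph G by fact
  let ?E = "edges_of (with_proj G)"
  obtain p where "cycle p" and len: "3 \<le> length p"
    using assms by (auto simp: undirected_tree_def)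
  then obtain u where p: "awalk u p u" "distinct (tl (pawalk_verts u p))"
    by (auto simp: cycle_def)
  obtain a1 a2 q where "p = a1 # a2 # q"
    using len by (cases p; cases "tl p") auto
  with len have pq: "p = a1 # a2 # q" "q \<noteq> []" by auto
  define b c where "b = snd a1" and "c = snd a2"
  have a: "a1 = (u, b)" "a2 = (b, c)" "pcas c q u" "set p \<subseteq> parcs G"
    using p(1) pq by (auto simp: awalk_def b_def c_def prod_eq_iff)
  have dist: "b \<notin> set (pawalk_verts c q)" "distinct (pawalk_verts c q)"
    using p(2) pq a by auto
  \<comment> \<open>This is where length at least 3 enters: a directed cycle of length 2 merely runs
    back along its own edge.\<close>
  have cu: "c \<noteq> u"
    using dist(2) a(3) pq(2) pcas_last[of _ "tl q" u] by (cases q) auto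
  have E: "{fst x, snd x} \<in> ?E" if "x \<in> set p" for x
    using that a(4) by (auto simp: in_edges_of_iff)
  txt \<open>The rest of the cycle avoids \<open>b\<close> after its first step, hence the edge \<open>{u, b}\<close> is redundant.\<close>
  let ?e = "{u, b}"
  have e: "?e \<in> ?E" using E[of a1] pq a by simp
  have bR: "b \<in> reach (?E - {?e}) {b}" by (simp add: reach.base)
  have "b \<noteq> u" using e by (auto elim!: edges_ofE simp: doubleton_eq_iff)
  then have "{b, c} \<in> ?E - {?e}"
    using E[of a2] pq a cu by (auto simp: doubleton_eq_iff)
  then have "c \<in> reach (?E - {?e}) {b}" by (intro reach.step[OF bR]) auto
  moreover have "{fst x, snd x} \<in> ?E - {?e}" if "x \<in> set q" for x
    using E[of x] that pq pcas_arc_verts[OF a(3) that] dist(1)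
    by (auto simp: doubleton_eq_iff)
  ultimately have uR: "u \<in> reach (?E - {?e}) {b}" using a(3) pcas_reach by metis
  have b: "b \<in> pverts G" using e by (auto elim!: edges_ofE simp: doubleton_eq_iff)
  interpret rooted_graph "pverts G" ?E "{b}"
    using assms(2) b by (rule rooted_graph_edges_of)
  have "pverts G \<subseteq> reach (?E - {?e}) ({b} \<union> ?e)"
    using reach_eq reach_contract[OF e, of "{b}"] by simp
  also have "\<dots> \<subseteq> reach (?E - {?e}) {b}"
    using uR bR by (intro reach_least) (auto intro: reach.step)
  finally have V: "pverts G \<subseteq> reach (?E - {?e}) {b}" .
  have "reach (?E - {?e}) {b} \<subseteq> pverts G"
    using reach_mono[of "?E - {?e}" ?E "{b}" "{b}"] reach_eq by auto
  with V have "card (pverts G) = card (reach (?E - {?e}) {b})" by (metis subset_antisym)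
  also have "\<dots> \<le> card {b} + card (?E - {?e})"
    using finE edge by (intro card_reach_le) auto
  also have "\<dots> = card ?E" using finE e by (simp add: card_Suc_Diff1 del: card_Diff_insert)
  finally show ?thesis .
qed

section \<open>Isomorphism with the tadpole graph\<close>

lemma path_edges_map: "path_edges (map f xs) = (`) f ` path_edges xs"
  by (induction xs rule: path_edges.induct) auto

lemma tadpole_verts:
  assumes "k + 3 \<le> n"
  shows "pverts (tadpole n (n - k)) = {..<n}"
  using assms by (auto simp: tadpole_def path_on_def cycle_on_def)

lemma path_on_arc_iff:
  "(a, b) \<in> parcs (path_on c d) \<longleftrightarrow> (b = Suc a \<and> c \<le> a \<and> a < d) \<or> (a = Suc b \<and> c \<le> b \<and> b < d)"
  by (auto simp: path_on_def)

lemma tadpole_arc_iff: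
  assumes "k + 3 \<le> n"
  shows "(a, b) \<in> parcs (tadpole n (n - k)) \<longleftrightarrow>
    (b = Suc a \<and> b < n) \<or> (a = Suc b \<and> a < n) \<or> (a = n - 1 \<and> b = k) \<or> (a = k \<and> b = n - 1)"
proof -
  have "n - (n - k) = k" using assms by simp
  then have "(a, b) \<in> parcs (tadpole n (n - k)) \<longleftrightarrow>
    (a, b) \<in> parcs (path_on 0 k) \<or> (a, b) \<in> parcs (path_on k (n - 1))
      \<or> (a = n - 1 \<and> b = k) \<or> (a = k \<and> b = n - 1)"
    by (auto simp: tadpole_def cycle_on_def)
  moreover have "Suc x < n \<longleftrightarrow> x < k \<or> k \<le> x \<and> x < n - 1" for x
    using assms by linarith
  ultimately show ?thesis unfolding path_on_arc_iff by blast
qed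

text \<open>Brings the tadpole into the list form used for counting, with the enumeration
  \<open>[0..<n]\<close> and the closing edge from \<open>n - 1\<close> back to
  \<open>k\<close>.\<close>

lemma edges_of_tadpole:
  assumes "k + 3 \<le> n"
  shows "edges_of (with_proj (tadpole n (n - k))) =
    insert {last [0..<n], [0..<n] ! k} (path_edges [0..<n])"
proof -
  have "path_edges [0..<n] = {{i, Suc i} |i. Suc i < n}"
    unfolding path_edges_conv_nth by (intro Collect_cong ex_cong1) auto
  moreover have "last [0..<n] = n - 1" "[0..<n] ! k = k"
    using assms by auto
  moreover have "edges_of (with_proj (tadpole n (n - k))) = insert {n - 1, k} {{i, Suc i} |i. Suc i < n}"
    (is "?L = ?R")
  proof
    show "?L \<subseteq> ?R"
    proof
      fix e assume "e \<in> ?L"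
      then obtain a b where "e = {a, b}" "(a, b) \<in> parcs (tadpole n (n - k))"
        by (auto simp: edges_of_def)
      then show "e \<in> ?R" unfolding tadpole_arc_iff[OF assms] by (auto simp: insert_commute)
    qed
    have "{n - 1, k} \<in> ?L"
      using tadpole_arc_iff[OF assms, of "n - 1" k]
      unfolding edges_of_def by (intro image_eqI[of _ _ "(n - 1, k)"]) auto
    moreover have "{i, Suc i} \<in> ?L" if "Suc i < n" for i
      using tadpole_arc_iff[OF assms, of i "Suc i"] that
      unfolding edges_of_def by (intro image_eqI[of _ _ "(i, Suc i)"]) auto
    ultimately show "?R \<subseteq> ?L" by blast
  qed
  ultimately show ?thesis by simp
qed

lemma pair_graph_tadpole:
  assumes "k + 3 \<le> n"
  shows "pair_graph (tadpole n (n - k))"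
proof -
  let ?T = "tadpole n (n - k)"
  have verts: "a < n \<and> b < n" if "(a, b) \<in> parcs ?T" for a b
    using that assms unfolding tadpole_arc_iff[OF assms] by auto
  show ?thesis
  proof
    show "finite (pverts ?T)" using tadpole_verts[OF assms] by simp
    show "finite (parcs ?T)"
    proof (rule finite_subset)
      show "parcs ?T \<subseteq> {..<n} \<times> {..<n}" by (rule subrelI) (use verts in simp)
    qed simp
    show "symmetric (with_proj ?T)"
      unfolding symmetric_def with_proj_simps
    proof (rule symI)
      fix a b assume "(a, b) \<in> parcs ?T"
      then show "(b, a) \<in> parcs ?T" unfolding tadpole_arc_iff[OF assms] by blast
    qed
    fix e assume eT: "e \<in> parcs ?T"
    obtain a b where ab: "e = (a, b)" by (cases e)
    note e = ab eT[unfolded ab]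
    show "fst e \<in> pverts ?T" "snd e \<in> pverts ?T"
      using verts[OF e(2)] e(1) tadpole_verts[OF assms] by auto
    show "fst e \<noteq> snd e"
      using e(2) assms unfolding tadpole_arc_iff[OF assms] e(1) by auto
  qed
qed

lemma pendant_vertex_tadpole_iff:
  assumes "1 \<le> k" "k + 3 \<le> n"
  shows "pendant_vertex (tadpole n (n - k)) u \<longleftrightarrow> u = 0"
proof
  let ?T = "tadpole n (n - k)"
  interpret pair_graph ?T using assms(2) by (rule pair_graph_tadpole)
  have out: "out_arcs (with_proj ?T) u = {(u, b) |b. (u, b) \<in> parcs ?T}" for u
    by (auto simp: out_arcs_def)
  show "pendant_vertex ?T u" if "u = 0"
  proof -
    have "out_arcs (with_proj ?T) 0 = {(0, 1)}"
      unfolding out tadpole_arc_iff[OF assms(2)] using assms by auto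
    then show ?thesis
      using that assms by (simp add: pendant_vertex_def out_degree_def tadpole_verts)
  qed
  assume pend: "pendant_vertex ?T u"
  show "u = 0"
  proof (rule ccontr)
    assume "u \<noteq> 0"
    have "u < n" using pend assms by (simp add: pendant_vertex_def tadpole_verts)
    \<comment> \<open>A second neighbour of \<open>u\<close>; for \<open>u = n - 1\<close> it is
      \<open>k\<close>, which differs from \<open>n - 2\<close> because
      \<open>k + 3 \<le> n\<close>.\<close>
    define b where "b = (if u = n - 1 then k else Suc u)"
    have "(u, u - 1) \<in> parcs ?T" "(u, b) \<in> parcs ?T"
      unfolding tadpole_arc_iff[OF assms(2)] b_def using \<open>u \<noteq> 0\<close> \<open>u < n\<close> by auto
    then have "{(u, u - 1), (u, b)} \<subseteq> out_arcs (with_proj ?T) u" by auto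
    moreover have "b \<noteq> u - 1" using assms \<open>u \<noteq> 0\<close> by (auto simp: b_def)
    then have "card {(u, u - 1), (u, b)} = 2" by auto
    ultimately have "2 \<le> out_degree (with_proj ?T) u"
      using card_mono[OF finite_out_arcs, of "{(u, u - 1), (u, b)}" u] by (simp add: out_degree_def)
    then show False using pend by (simp add: pendant_vertex_def)
  qed
qed

text \<open>An isomorphism sending \<open>v\<close> to the pendant vertex \<open>0\<close> amounts
  to an enumeration of the vertices starting with \<open>v\<close>. In both directions
  \<open>p\<close> is the enumeration and \<open>f\<close> its inverse.\<close>

lemma tadpole_isomorphism_iff:
  assumes "pair_graph G" "v \<in> pverts G" "1 \<le> k" "k + 3 \<le> n" "card (pverts G) = n"
  shows "(\<exists>\<phi>. graph_isomorphism \<phi> G (tadpole n (n - k))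
        \<and> pendant_vertex (tadpole n (n - k)) (iso_verts \<phi> v)) \<longleftrightarrow>
    (\<exists>xs. distinct (v # xs) \<and> set xs = pverts G - {v}
       \<and> edges_of (with_proj G) = insert {last (v # xs), (v # xs) ! k} (path_edges (v # xs)))"
proof
  let ?T = "tadpole n (n - k)"
  interpret pair_graph G by fact
  interpret T: pair_graph ?T using assms(4) by (rule pair_graph_tadpole)
  note TV = tadpole_verts[OF assms(4)]
  {
    assume "\<exists>\<phi>. graph_isomorphism \<phi> G ?T \<and> pendant_vertex ?T (iso_verts \<phi> v)"
    then obtain \<phi> where iso: "digraph_isomorphism \<phi>" "with_proj ?T = app_iso \<phi> (with_proj G)"
      and pend: "pendant_vertex ?T (iso_verts \<phi> v)"
      unfolding graph_isomorphism_def by blast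
    define f where "f = iso_verts \<phi>"
    define p where "p = the_inv_into (pverts G) f"
    have inj: "inj_on f (pverts G)" using iso(1) by (simp add: digraph_isomorphism_def f_def)
    have verts: "f ` pverts G = {..<n}"
      using arg_cong[OF iso(2), of verts] TV by (simp add: f_def)
    have pf: "p (f x) = x" if "x \<in> pverts G" for x
      unfolding p_def using inj that by (rule the_inv_into_f_f)
    have "f v = 0" using pend pendant_vertex_tadpole_iff[OF assms(3,4)] by (simp add: f_def)
    then have p0: "p 0 = v" using pf[OF assms(2)] by simp
    \<comment> \<open>Both digraphs use the projections as tail and head, so the isomorphism has to
      act on arcs componentwise by \<open>f\<close>.\<close>
    have ends: "iso_head \<phi> = snd" "iso_tail \<phi> = fst"
      using arg_cong[OF iso(2), of head] arg_cong[OF iso(2), of tail] by auto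
    have arcs: "iso_arcs \<phi> (a, b) = (f a, f b)" if "(a, b) \<in> parcs G" for a b
      using iso(1) that unfolding digraph_isomorphism_def ends f_def
      by (auto simp: prod_eq_iff)
    have parcs: "parcs ?T = iso_arcs \<phi> ` parcs G"
      using arg_cong[OF iso(2), of arcs] by simp
    have E: "edges_of (with_proj G) = (`) p ` edges_of (with_proj ?T)"
    proof -
      have "(\<lambda>a. p ` {fst (iso_arcs \<phi> a), snd (iso_arcs \<phi> a)}) a = {fst a, snd a}"
        if "a \<in> parcs G" for a
        using that arcs[of "fst a" "snd a"] pf in_arcsD1[of "fst a" "snd a"] in_arcsD2[of "fst a" "snd a"]
        by simp
      then show ?thesis
        by (simp add: edges_of_def parcs image_image)
    qed
    define ys where "ys = map p [0..<n]"
    have "bij_betw p {..<n} (pverts G)"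
      unfolding p_def using inj verts by (intro bij_betw_the_inv_into) (simp add: bij_betw_def)
    then have "distinct ys" "set ys = pverts G"
      by (auto simp: ys_def distinct_map bij_betw_def atLeast0LessThan)
    moreover have "ys = v # tl ys"
      using p0 assms(4) by (cases n) (auto simp: ys_def upt_rec)
    moreover have "edges_of (with_proj G) = insert {last ys, ys ! k} (path_edges ys)"
      unfolding E edges_of_tadpole[OF assms(4)] ys_def path_edges_map
      using assms(4) by (simp add: last_map)
    ultimately have "distinct (v # tl ys) \<and> set (tl ys) = pverts G - {v} \<and>
      edges_of (with_proj G) = insert {last (v # tl ys), (v # tl ys) ! k} (path_edges (v # tl ys))"
      by (metis Diff_insert_absorb distinct.simps(2) list.simps(15))
    then show "\<exists>xs. distinct (v # xs) \<and> set xs = pverts G - {v}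
       \<and> edges_of (with_proj G) = insert {last (v # xs), (v # xs) ! k} (path_edges (v # xs))"
      by blast
  }
  assume "\<exists>xs. distinct (v # xs) \<and> set xs = pverts G - {v}
       \<and> edges_of (with_proj G) = insert {last (v # xs), (v # xs) ! k} (path_edges (v # xs))"
  then obtain xs where xs: "distinct (v # xs)" "set xs = pverts G - {v}"
    "edges_of (with_proj G) = insert {last (v # xs), (v # xs) ! k} (path_edges (v # xs))" by blast
  define ys where "ys = v # xs"
  define p where "p = (!) ys"
  have set: "set ys = pverts G" using xs assms(2) by (auto simp: ys_def)
  have "distinct ys" using xs(1) by (simp add: ys_def)
  then have len: "length ys = n" using distinct_card[of ys] set assms(5) by simp
  have ysp: "ys = map p [0..<n]" unfolding p_def len[symmetric] by (rule map_nth[symmetric])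
  have inj: "inj_on p {..<n}" using \<open>distinct ys\<close> len by (simp add: p_def inj_on_nth)
  have img: "p ` {..<n} = pverts G"
    using set len by (auto simp: p_def set_conv_nth)
  define f where "f = the_inv_into {..<n} p"
  have fp: "f (p i) = i" if "i < n" for i
    unfolding f_def using inj that by (intro the_inv_into_f_f) auto
  have bij: "bij_betw f (pverts G) {..<n}"
    unfolding f_def using inj img by (intro bij_betw_the_inv_into) (simp add: bij_betw_def)
  have E: "edges_of (with_proj G) = (`) p ` edges_of (with_proj ?T)"
    unfolding edges_of_tadpole[OF assms(4)] xs(3) ys_def[symmetric]
    unfolding ysp path_edges_map using assms(4) by (simp add: last_map)
  have parcs: "parcs G = map_prod p p ` parcs ?T"
  proof
    show "map_prod p p ` parcs ?T \<subseteq> parcs G"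
    proof (rule image_subsetI)
      fix x assume x: "x \<in> parcs ?T"
      obtain a b where ab: "x = (a, b)" by (cases x)
      then have "p ` {a, b} \<in> edges_of (with_proj G)"
        unfolding E using T.in_edges_of_iff x by blast
      then show "map_prod p p x \<in> parcs G" using in_edges_of_iff ab by simp
    qed
    show "parcs G \<subseteq> map_prod p p ` parcs ?T"
    proof (rule subrelI)
      fix a b assume "(a, b) \<in> parcs G"
      then have "{a, b} \<in> (`) p ` edges_of (with_proj ?T)" using in_edges_of_iff E by simp
      then obtain i j where ij: "{a, b} = {p i, p j}" "(i, j) \<in> parcs ?T" by (auto elim!: T.edges_ofE)
      then have "(a, b) = map_prod p p (i, j) \<or> (a, b) = map_prod p p (j, i)"
        by (auto simp: doubleton_eq_iff)
      then show "(a, b) \<in> map_prod p p ` parcs ?T" using ij(2) T.arcs_symmetric by blast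
    qed
  qed
  have fparcs: "map_prod f f ` parcs G = parcs ?T"
  proof -
    have "map_prod f f (map_prod p p a) = a" if "a \<in> parcs ?T" for a
      using that T.in_arcsD1[of "fst a" "snd a"] T.in_arcsD2[of "fst a" "snd a"] TV fp
      by (cases a) auto
    then show ?thesis by (simp add: parcs image_image)
  qed
  define \<phi> where "\<phi> = \<lparr>iso_verts = f, iso_arcs = map_prod f f, iso_head = snd, iso_tail = fst\<rparr>"
  have "parcs G \<subseteq> pverts G \<times> pverts G" using in_arcsD1 in_arcsD2 by auto
  then have "inj_on (map_prod f f) (parcs G)"
    using bij map_prod_inj_on[of f "pverts G" f "pverts G"]
    by (auto simp: bij_betw_def intro: inj_on_subset)
  then have "digraph_isomorphism \<phi>"
    using bij wf by (simp add: digraph_isomorphism_def \<phi>_def bij_betw_def)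
  moreover have "with_proj ?T = app_iso \<phi> (with_proj G)"
    using fparcs bij TV by (simp add: app_iso_def \<phi>_def with_proj_def bij_betw_def)
  ultimately have "graph_isomorphism \<phi> G ?T" by (simp add: graph_isomorphism_def)
  moreover have "f v = 0" using fp[of 0] assms(4) by (simp add: p_def ys_def)
  then have "pendant_vertex ?T (iso_verts \<phi> v)"
    using pendant_vertex_tadpole_iff[OF assms(3,4)] by (simp add: \<phi>_def)
  ultimately show "\<exists>\<phi>. graph_isomorphism \<phi> G ?T \<and> pendant_vertex ?T (iso_verts \<phi> v)" by blast
qed

section \<open>The bound and its equality case for a single root vertex\<close>

theorem theorem3p16:
  fixes n k :: nat and G :: "'a pair_pre_digraph"
  assumes "1 \<le> k" and "k + 3 \<le> n"
    and "G \<in> nontree_graphs_with_cut_vertices n k"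
  shows "\<forall>v \<in> pverts G.
    real (num_connected_subgraphs_at G v) \<ge> ((real n - real k)\<^sup>2 + real n + real k + 2) / 2
    \<and> (real (num_connected_subgraphs_at G v) = ((real n - real k)\<^sup>2 + real n + real k + 2) / 2
       \<longleftrightarrow> (\<exists>\<phi>. graph_isomorphism \<phi> G (tadpole n (n - k))
              \<and> pendant_vertex (tadpole n (n - k)) (iso_verts \<phi> v)))"
proof
  fix v assume v: "v \<in> pverts G"
  have G: "pair_graph G" "Digraph_Component.connected (with_proj G)" "\<not> undirected_tree G"
      "card (pverts G) = n" "card {u. cut_vertex G u} = k"
    using assms(3) by (auto simp: nontree_graphs_with_cut_vertices_def graphs_with_cut_vertices_def)
  interpret pair_graph G by fact
  let ?E = "edges_of (with_proj G)" and ?N = "num_connected_subgraphs_at G v"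
  \<comment> \<open>\<open>?c\<close> does not count \<open>v\<close>, so it drops to
    \<open>k - 1\<close> if \<open>v\<close> is itself a cut vertex; \<open>?g\<close> is the
    claimed bound as a natural number.\<close>
  let ?c = "card (cuts (pverts G) ?E {v})" and ?g = "k + (\<Sum>i\<le>n - k. i) + 1"
  have N: "?N = num_rooted ?E {v}" using num_connected_subgraphs_at_eq[OF G(1) v] .
  have rg: "rooted_graph (pverts G) ?E {v}" using G(2) v by (rule rooted_graph_edges_of)
  have cV: "Suc (card (pverts G - {v})) = n"
    using pair_finite_verts v G(4) card_Suc_Diff1[of "pverts G" v] by simp
  have more: "card (pverts G - {v}) < card ?E"
    using card_verts_le_card_edges[OF G(1,2,3)] G(4) cV by linarith
  have lb: "?c + (\<Sum>i\<le>n - ?c. i) + 1 \<le> ?N"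
    using num_rooted_lower_bound[OF rg more] cV N by simp
  have "finite {u. cut_vertex G u}"
    by (rule finite_subset[OF _ pair_finite_verts]) (auto simp: cut_vertex_def)
  then have "?c = (if cut_vertex G v then k - 1 else k)"
    using cuts_eq[OF v] G(5) by simp
  then consider "?c = k" | "?c = k - 1" by metis
  then have bound: "?g \<le> ?N \<and> (?N = ?g \<longrightarrow> ?c = k)"
  proof cases
    \<comment> \<open>One cut vertex fewer raises the lower bound to \<open>?g + (n - k)\<close>, so
      equality is impossible at a cut vertex.\<close>
    case 2
    then have "n - ?c = Suc (n - k)" using assms by simp
    then have "?c + (\<Sum>i\<le>n - ?c. i) + 1 = ?g + (n - k)" using 2 assms(1) by simp
    then show ?thesis using lb assms by simp
  qed (use lb in simp)
  have "?N = ?g \<longleftrightarrow> (\<exists>xs. distinct (v # xs) \<and> set xs = pverts G - {v}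
       \<and> ?E = insert {last (v # xs), (v # xs) ! k} (path_edges (v # xs)))" (is "_ \<longleftrightarrow> ?R")
  proof
    assume eq: "?N = ?g"
    then have c: "?c = k" using bound by blast
    show ?R
      using cV assms(2) eq N by (intro tadpole_of_num_rooted_eq[OF rg _ _ more c]) auto
  next
    assume ?R
    then obtain xs where xs: "distinct (v # xs)" "set xs = pverts G - {v}"
      "?E = insert {last (v # xs), (v # xs) ! k} (path_edges (v # xs))" by blast
    have "Suc (length xs) = n" using xs(1,2) cV distinct_card[of xs] by simp
    then show "?N = ?g"
      using num_rooted_tadpole[of v "{v}" xs k] xs N assms(2) by simp
  qed
  then have eq: "?N = ?g \<longleftrightarrow> (\<exists>\<phi>. graph_isomorphism \<phi> G (tadpole n (n - k))
              \<and> pendant_vertex (tadpole n (n - k)) (iso_verts \<phi> v))"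
    using tadpole_isomorphism_iff[OF G(1) v assms(1,2) G(4)] by simp
  have "2 * (\<Sum>i\<le>n - k. i) = (n - k) * Suc (n - k)"
    using gauss_sum[of "n - k", where 'a = nat] by (simp add: atMost_atLeast0)
  then have "2 * real (\<Sum>i\<le>n - k. i) = (real n - real k) * (real n - real k + 1)"
    using assms(2) by (metis (no_types, lifting) add_leE add.commute of_nat_Suc of_nat_diff of_nat_mult of_nat_numeral)
  then have g: "real ?g = ((real n - real k)\<^sup>2 + real n + real k + 2) / 2"
    by (simp add: power2_eq_square algebra_simps)
  show "real ?N \<ge> ((real n - real k)\<^sup>2 + real n + real k + 2) / 2
    \<and> (real ?N = ((real n - real k)\<^sup>2 + real n + real k + 2) / 2
       \<longleftrightarrow> (\<exists>\<phi>. graph_isomorphism \<phi> G (tadpole n (n - k))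
              \<and> pendant_vertex (tadpole n (n - k)) (iso_verts \<phi> v)))"
    using bound eq unfolding g[symmetric] of_nat_le_iff of_nat_eq_iff by blast
qed

end
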